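(* Consider the two-stage inventory problem described in the context with $y_1=0$, $\rho=1$, $$\mathcal I_1=[1,3],\ \mu_1=2,\ \sigma_1=1,\ c_1=0,\ b_1=1,\ h_1=1;\qquad \mathcal I_2=\mathbb R_+,\ \mu_2=10,\ \sigma_2=1,\ c_2=0,\ b_2=1,\ h_2=1.$$ Then the multistage-static problem is weakly time consistent, but not strongly time consistent.
   Context: Two-stage setting ($T=2$). $\rho\in(0,1]$ is a discount factor, $y_1\in\mathbb R$ a given initial inventory level. For $t=1,2$: $c_t,b_t,h_t\ge 0$ are ordering, backorder and holding costs; $\mathcal I_t\subseteq\mathbb R_+$ is a closed interval; $\mathcal M_t$ is the set of probability measures $Q_t$ on $\mathbb R$ with support in $\mathcal I_t$, $\mathbb E_{Q_t}[D_t]=\mu_t$, $\mathbb E_{Q_t}[D_t^2]=\mu_t^2+\sigma_t^2$. Let $\mathcal M=\{Q_1\times Q_2: Q_1\in\mathcal M_1,\ Q_2\in\mathcal M_2\}$ (product measures for $(D_1,D_2)$). Write $[a]_+=\max\{a,0\}$. Policies. $\Pi$ is the set of admissible policies $\pi=(x_1,x_2)$, where $x_1\in\mathbb R$ is a constant with $x_1\ge y_1$ and $x_2:\mathbb R_+\to\mathbb R$ is a measurable function of the first-stage demand $d_1$ with $x_2(d_1)\ge y_2(d_1):=x_1-d_1$ for all $d_1\in\mathbb R_+$. Costs. $\Psi_t(x,d)=b_t[d-x]_++h_t[x-d]_+$ and $$Z^\pi(D_1,D_2)=c_1(x_1-y_1)+\Psi_1(x_1,D_1)+\rho\big[c_2(x_2(D_1)-y_2(D_1))+\Psi_2(x_2(D_1),D_2)\big].$$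 Multistage-static problem: $\inf_{\pi\in\Pi}\sup_{Q\in\mathcal M}\mathbb E_Q[Z^\pi]$; $\pi$ is optimal if it attains the infimum. Distributionally robust DP problem: $V_3\equiv0$ and, for $t=2,1$, $$V_t(y)=\inf_{x\ge y}\Big\{c_t(x-y)+\sup_{Q_t\in\mathcal M_t}\mathbb E_{Q_t}[\Psi_t(x,D_t)+\rho V_{t+1}(x-D_t)]\Big\},$$ $\mathcal Y_t(y)$ is the set of minimizers $x\ge y$, and the optimal value is $V_1(y_1)$. A policy $\pi\in\Pi$ is robust-w.p.1-optimal for the DP problem if $x_1\in\mathcal Y_1(y_1)$ and, for every $Q\in\mathcal M$, $x_2(D_1)\in\mathcal Y_2(y_2(D_1))$ with probability one under $Q$. Time consistency. A policy is time consistent if it is optimal for the multistage-static problem and robust-w.p.1-optimal for the DP problem. The multistage-static problem is weakly time consistent if at least one of its optimal policies is time consistent, and strongly time consistent if every one of its optimal policies is time consistent. *)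

theory Defs
  imports "HOL-Probability.Probability"
begin

text \<open>
  All costs are nonnegative under the standing assumptions, so every expected cost is taken as a
  Lebesgue integral with values in \<^typ>\<open>ennreal\<close>. It is thus defined for every admissible policy,
  and suprema over ambiguity sets may be infinite.
\<close>

locale two_stage_inventory =
  fixes \<rho> :: real
    and y\<^sub>1 :: real
    and c b h :: "nat \<Rightarrow> real"
    and I :: "nat \<Rightarrow> real set"
    and \<mu> \<sigma> :: "nat \<Rightarrow> real"
  assumes discount: "0 < \<rho>" "\<rho> \<le> 1"
    and costs_nonneg: "t \<in> {1, 2} \<Longrightarrow> 0 \<le> c t \<and> 0 \<le> b t \<and> 0 \<le> h t"
    and support_interval: "t \<in> {1, 2} \<Longrightarrow> closed (I t) \<and> is_interval (I t) \<and> I t \<subseteq> {0..}"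
begin

text \<open>As \<^term>\<open>I t\<close> is closed, a measure has its support in \<^term>\<open>I t\<close> iff it is concentrated on it.\<close>

definition ambiguity :: "nat \<Rightarrow> real measure set" where
  "ambiguity t = {Q. prob_space Q \<and> sets Q = sets borel \<and> (AE d in Q. d \<in> I t) \<and>
     has_bochner_integral Q (\<lambda>d. d) (\<mu> t) \<and>
     has_bochner_integral Q (\<lambda>d. d\<^sup>2) ((\<mu> t)\<^sup>2 + (\<sigma> t)\<^sup>2)}"

definition joint_ambiguity :: "(real \<times> real) measure set" where
  "joint_ambiguity = {Q\<^sub>1 \<Otimes>\<^sub>M Q\<^sub>2 | Q\<^sub>1 Q\<^sub>2. Q\<^sub>1 \<in> ambiguity 1 \<and> Q\<^sub>2 \<in> ambiguity 2}"

text \<open>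
  A policy is a pair \<^term>\<open>(x\<^sub>1, x\<^sub>2)\<close>. Only the restriction of \<^term>\<open>x\<^sub>2\<close> to the nonnegative reals
  matters, because first-stage demand is almost surely nonnegative.
\<close>

definition policies :: "(real \<times> (real \<Rightarrow> real)) set" where
  "policies = {(x\<^sub>1, x\<^sub>2). x\<^sub>1 \<ge> y\<^sub>1 \<and> x\<^sub>2 \<in> borel_measurable (restrict_space borel {0..}) \<and>
     (\<forall>d\<ge>0. x\<^sub>2 d \<ge> x\<^sub>1 - d)}"

definition \<Psi> :: "nat \<Rightarrow> real \<Rightarrow> real \<Rightarrow> real" where
  "\<Psi> t x d = b t * max (d - x) 0 + h t * max (x - d) 0"

definition Z :: "real \<times> (real \<Rightarrow> real) \<Rightarrow> real \<Rightarrow> real \<Rightarrow> real" where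
  "Z \<pi> d\<^sub>1 d\<^sub>2 = (case \<pi> of (x\<^sub>1, x\<^sub>2) \<Rightarrow>
     c 1 * (x\<^sub>1 - y\<^sub>1) + \<Psi> 1 x\<^sub>1 d\<^sub>1 +
     \<rho> * (c 2 * (x\<^sub>2 d\<^sub>1 - (x\<^sub>1 - d\<^sub>1)) + \<Psi> 2 (x\<^sub>2 d\<^sub>1) d\<^sub>2))"

definition static_cost :: "real \<times> (real \<Rightarrow> real) \<Rightarrow> ennreal" where
  "static_cost \<pi> = (SUP Q\<in>joint_ambiguity. \<integral>\<^sup>+(d\<^sub>1, d\<^sub>2). ennreal (Z \<pi> d\<^sub>1 d\<^sub>2) \<partial>Q)"

definition static_optimal :: "real \<times> (real \<Rightarrow> real) \<Rightarrow> bool" where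
  "static_optimal \<pi> \<longleftrightarrow> \<pi> \<in> policies \<and> static_cost \<pi> = (INF \<pi>'\<in>policies. static_cost \<pi>')"

text \<open>In the dynamic programming recursion, \<^term>\<open>W\<close> stands for the value function of stage \<^term>\<open>t + 1\<close>.\<close>

definition dp_objective :: "nat \<Rightarrow> (real \<Rightarrow> ennreal) \<Rightarrow> real \<Rightarrow> real \<Rightarrow> ennreal" where
  "dp_objective t W y x = ennreal (c t * (x - y)) +
     (SUP Q\<in>ambiguity t. \<integral>\<^sup>+d. (ennreal (\<Psi> t x d) + ennreal \<rho> * W (x - d)) \<partial>Q)"

definition dp_value :: "nat \<Rightarrow> (real \<Rightarrow> ennreal) \<Rightarrow> real \<Rightarrow> ennreal" where
  "dp_value t W y = (INF x\<in>{y..}. dp_objective t W y x)"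

definition dp_minimizers :: "nat \<Rightarrow> (real \<Rightarrow> ennreal) \<Rightarrow> real \<Rightarrow> real set" where
  "dp_minimizers t W y = {x\<in>{y..}. dp_objective t W y x = dp_value t W y}"

definition V\<^sub>3 :: "real \<Rightarrow> ennreal" where "V\<^sub>3 = (\<lambda>_. 0)"
definition V\<^sub>2 :: "real \<Rightarrow> ennreal" where "V\<^sub>2 = dp_value 2 V\<^sub>3"
definition V\<^sub>1 :: "real \<Rightarrow> ennreal" where "V\<^sub>1 = dp_value 1 V\<^sub>2"

definition Y\<^sub>2 :: "real \<Rightarrow> real set" where "Y\<^sub>2 = dp_minimizers 2 V\<^sub>3"
definition Y\<^sub>1 :: "real \<Rightarrow> real set" where "Y\<^sub>1 = dp_minimizers 1 V\<^sub>2"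

definition robust_wp1_optimal :: "real \<times> (real \<Rightarrow> real) \<Rightarrow> bool" where
  "robust_wp1_optimal \<pi> \<longleftrightarrow> \<pi> \<in> policies \<and>
     (case \<pi> of (x\<^sub>1, x\<^sub>2) \<Rightarrow> x\<^sub>1 \<in> Y\<^sub>1 y\<^sub>1 \<and>
        (\<forall>Q\<in>joint_ambiguity. AE (d\<^sub>1, d\<^sub>2) in Q. x\<^sub>2 d\<^sub>1 \<in> Y\<^sub>2 (x\<^sub>1 - d\<^sub>1)))"

definition time_consistent :: "real \<times> (real \<Rightarrow> real) \<Rightarrow> bool" where
  "time_consistent \<pi> \<longleftrightarrow> static_optimal \<pi> \<and> robust_wp1_optimal \<pi>"

definition weakly_time_consistent :: bool where
  "weakly_time_consistent \<longleftrightarrow> (\<exists>\<pi>. static_optimal \<pi> \<and> time_consistent \<pi>)"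

definition strongly_time_consistent :: bool where
  "strongly_time_consistent \<longleftrightarrow> (\<forall>\<pi>. static_optimal \<pi> \<longrightarrow> time_consistent \<pi>)"

end

end

theory Submission
  imports Defs
begin

text \<open>
  Support and moments force the first-stage law to be uniform on \<open>{1, 3}\<close>, although the bounds only
  use that it has mean \<open>2\<close> and support in \<open>[1, 3]\<close>. Both problems have value \<open>2\<close>: costs are bounded
  below by testing against the uniform laws on \<open>{1, 3}\<close> and \<open>{9, 11}\<close>, and \<open>x\<^sub>1 = 2\<close> followed by
  ordering up to \<open>10\<close> attains the bound because \<open>\<bar>u\<bar> \<le> (u\<^sup>2 + 1) / 2\<close>. In the static problem the worst case over \<open>Q\<^sub>2\<close> is taken
  after averaging over \<open>D\<^sub>1\<close>, so the order-up-to levels \<open>9.5\<close> and \<open>10.5\<close> after the demands \<open>1\<close> and \<open>3\<close>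
  are optimal as well: the average of \<open>\<bar>u - 1/2\<bar>\<close> and \<open>\<bar>u + 1/2\<bar>\<close> is \<open>max \<bar>u\<bar> (1/2) \<le> (u\<^sup>2 + 1) / 2\<close>.
  Stage by stage, however, \<open>9.5\<close> is suboptimal, as the law on \<open>{8, 10.5}\<close> with weights \<open>1/5, 4/5\<close> shows.
\<close>

section \<open>Two-point laws and almost-sure statements\<close>

text \<open>Pushing the Bernoulli law forward to \<open>borel\<close> supplies the sigma-algebra
  required by \<open>ambiguity\<close>; a pmf viewed as a measure makes every set
  measurable.\<close>

definition two_point :: "real \<Rightarrow> real \<Rightarrow> real \<Rightarrow> real measure" where
  "two_point p a b = distr (measure_pmf (bernoulli_pmf p)) borel (\<lambda>z. if z then a else b)"

lemma sets_two_point [simp, measurable_cong]: "sets (two_point p a b) = sets borel"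
  by (simp add: two_point_def)

lemma prob_space_two_point: "prob_space (two_point p a b)"
  unfolding two_point_def by (rule measure_pmf.prob_space_distr) simp

lemma AE_two_point_iff:
  assumes "0 < p" "p < 1" and [measurable]: "Measurable.pred borel P"
  shows "(AE d in two_point p a b. P d) \<longleftrightarrow> P a \<and> P b"
proof -
  have "(AE d in two_point p a b. P d) \<longleftrightarrow> (AE z in measure_pmf (bernoulli_pmf p). P (if z then a else b))"
    unfolding two_point_def by (rule AE_distr_iff) (auto simp flip: pred_def)
  then show ?thesis
    using assms(1,2) by (simp add: AE_measure_pmf_iff set_pmf_bernoulli split: if_splits) blast
qed

text \<open>Stated for an arbitrary predicate because it is applied to membership in
  \<open>Y\<^sub>2\<close>, whose measurability is never established.\<close>

lemma AE_two_pointD: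
  assumes "AE d in two_point p a b. P d" "0 < p" "p < 1"
  shows "P a"
proof -
  have "AE z in measure_pmf (bernoulli_pmf p). P (if z then a else b)"
    by (rule AE_distrD[OF _ assms(1)[unfolded two_point_def]]) simp
  then have "\<forall>z. P (if z then a else b)"
    using assms(2,3) by (simp add: AE_measure_pmf_iff set_pmf_bernoulli)
  from spec[OF this, of True] show ?thesis by simp
qed

lemma has_bochner_integral_two_point:
  assumes "0 \<le> p" "p \<le> 1" and [measurable]: "f \<in> borel_measurable borel"
  shows "has_bochner_integral (two_point p a b) f (p * f a + (1 - p) * f b)"
  using assms unfolding two_point_def has_bochner_integral_iff
  by (auto simp: integrable_distr_eq integral_distr intro!: integrable_measure_pmf_finite)

lemma nn_integral_two_point:
  assumes "0 \<le> p" "p \<le> 1" and "f \<in> borel_measurable borel" "\<And>d. 0 \<le> f d"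
  shows "(\<integral>\<^sup>+d. ennreal (f d) \<partial>two_point p a b) = ennreal (p * f a + (1 - p) * f b)"
  using has_bochner_integral_two_point[of p f a b] assms
  by (simp add: has_bochner_integral_iff nn_integral_eq_integral)

lemma nn_integral_eq_has_bochner_integral:
  assumes "has_bochner_integral M f r" "AE x in M. 0 \<le> f x"
  shows "(\<integral>\<^sup>+x. ennreal (f x) \<partial>M) = ennreal r"
  using assms by (simp add: has_bochner_integral_iff nn_integral_eq_integral)

lemma (in pair_prob_space) AE_pair_fst:
  assumes "AE x in M1. P x" and [measurable]: "Measurable.pred M1 P"
  shows "AE z in M1 \<Otimes>\<^sub>M M2. P (fst z)"
  using assms(1) by (intro AE_pair_measure) auto

section \<open>Bounds of absolute values by parabolas\<close>

text \<open>With \<open>u = 10 - d\<close>, equality holds exactly at the demands 9 and 11, the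
  atoms of the testing law; hence upper and lower bounds meet.\<close>

lemma abs_le_half_square: "\<bar>u\<bar> \<le> (u\<^sup>2 + 1) / 2" for u :: real
proof -
  have "0 \<le> (\<bar>u\<bar> - 1)\<^sup>2" by simp
  then show ?thesis by (simp add: power2_diff)
qed

text \<open>
  The chord of \<open>s \<mapsto> \<bar>u - k * s\<bar>\<close> over \<open>[-1, 1]\<close>; its slope does not depend on \<open>s\<close>, so it averages
  out when \<open>s\<close> has mean zero.
\<close>

lemma abs_diff_le_chord:
  fixes u k s :: real
  assumes "0 \<le> k" "k \<le> 1/2" "-1 \<le> s" "s \<le> 1"
  shows "\<bar>u - k * s\<bar> \<le> (u\<^sup>2 + 1) / 2 + s * ((\<bar>u - k\<bar> - \<bar>u + k\<bar>) / 2)"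
proof -
  have "u - k * s = (1 - s) / 2 * (u + k) + (1 + s) / 2 * (u - k)"
    by (simp add: field_simps)
  then have "\<bar>u - k * s\<bar> \<le> \<bar>(1 - s) / 2 * (u + k)\<bar> + \<bar>(1 + s) / 2 * (u - k)\<bar>"
    by (metis abs_triangle_ineq)
  also have "\<dots> = (1 - s) / 2 * \<bar>u + k\<bar> + (1 + s) / 2 * \<bar>u - k\<bar>"
    using assms by (simp add: abs_mult)
  also have "\<dots> = (\<bar>u + k\<bar> + \<bar>u - k\<bar>) / 2 + s * ((\<bar>u - k\<bar> - \<bar>u + k\<bar>) / 2)"
    by (simp add: field_simps)
  \<comment> \<open>For \<open>0 \<le> k\<close> this average equals
    \<open>max \<bar>u\<bar> k\<close>. A slope up to 1/2 is harmless because the parabola never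
    drops below 1/2.\<close>
  also have "(\<bar>u + k\<bar> + \<bar>u - k\<bar>) / 2 \<le> max \<bar>u\<bar> (1/2)"
    using assms by (auto simp: max_def abs_if)
  also have "\<dots> \<le> (u\<^sup>2 + 1) / 2"
    using abs_le_half_square[of u] by (auto simp: max_def)
  finally show ?thesis by simp
qed

section \<open>The instance and its ambiguity sets\<close>

locale counterexample_instance = two_stage_inventory +
  assumes params: "y\<^sub>1 = 0" "\<rho> = 1"
    and params1: "I 1 = {1..3}" "\<mu> 1 = 2" "\<sigma> 1 = 1" "c 1 = 0" "b 1 = 1" "h 1 = 1"
    and params2: "I 2 = {0..}" "\<mu> 2 = 10" "\<sigma> 2 = 1" "c 2 = 0" "b 2 = 1" "h 2 = 1"
begin

text \<open>
  Rewriting with \<open>params\<close> itself would also rewrite the locale parameters hidden in \<open>V\<^sub>2\<close>, \<open>Z\<close>, etc.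
\<close>

lemma params_simps:
  "y\<^sub>1 \<le> r \<longleftrightarrow> 0 \<le> r" "\<rho> * r = r" "ennreal \<rho> = 1"
  using params by simp_all

lemma Psi_eq: "t \<in> {1, 2} \<Longrightarrow> \<Psi> t x d = \<bar>x - d\<bar>"
  using params1 params2 by (auto simp: \<Psi>_def)

lemma Z_eq: "Z (x\<^sub>1, x\<^sub>2) d\<^sub>1 d\<^sub>2 = \<bar>x\<^sub>1 - d\<^sub>1\<bar> + \<bar>x\<^sub>2 d\<^sub>1 - d\<^sub>2\<bar>"
  using params1 params2 by (simp add: Z_def Psi_eq params_simps)

lemma two_point_in_ambiguity:
  assumes "0 < p" "p < 1" "a \<in> I t" "b' \<in> I t" "t \<in> {1, 2}"
    and "p * a + (1 - p) * b' = \<mu> t" "p * a\<^sup>2 + (1 - p) * b'\<^sup>2 = (\<mu> t)\<^sup>2 + (\<sigma> t)\<^sup>2"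
  shows "two_point p a b' \<in> ambiguity t"
  unfolding ambiguity_def mem_Collect_eq
proof (intro conjI)
  have "closed (I t)"
    using support_interval[OF assms(5)] by simp
  then have "Measurable.pred borel (\<lambda>d. d \<in> I t)"
    by (simp add: pred_def borel_closed)
  then show "AE d in two_point p a b'. d \<in> I t"
    using assms(1-4) by (subst AE_two_point_iff) auto
  show "has_bochner_integral (two_point p a b') (\<lambda>d. d) (\<mu> t)"
    unfolding assms(6)[symmetric] using assms(1,2) by (intro has_bochner_integral_two_point) auto
  show "has_bochner_integral (two_point p a b') (\<lambda>d. d\<^sup>2) ((\<mu> t)\<^sup>2 + (\<sigma> t)\<^sup>2)"
    unfolding assms(7)[symmetric] using assms(1,2) by (intro has_bochner_integral_two_point) auto
qed (simp_all add: prob_space_two_point)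

lemma symmetric_in_ambiguity:
  "two_point (1/2) 1 3 \<in> ambiguity 1" "two_point (1/2) 9 11 \<in> ambiguity 2"
  by (rule two_point_in_ambiguity; simp add: params1 params2 del: One_nat_def)+

text \<open>The worst law for the level 19/2 sits at 19/2 plus or minus sqrt(5)/2 and costs
  sqrt(5)/2; this is a nearby law with rational data.\<close>

lemma skewed_in_ambiguity: "two_point (1/5) 8 (21/2) \<in> ambiguity 2"
  by (rule two_point_in_ambiguity; simp add: params2 power2_eq_square)

text \<open>Triangle inequality: the two demands are 2 apart. As \<open>x\<close> is arbitrary, the
  bound also covers levels chosen after the first demand is seen.\<close>

lemma one_le_nn_integral_symmetric:
  "1 \<le> (\<integral>\<^sup>+d. ennreal \<bar>x - d\<bar> \<partial>two_point (1/2) 1 3)"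
  "1 \<le> (\<integral>\<^sup>+d. ennreal \<bar>x - d\<bar> \<partial>two_point (1/2) 9 11)"
proof -
  have "1 \<le> (\<integral>\<^sup>+d. ennreal \<bar>x - d\<bar> \<partial>two_point (1/2) (m - 1) (m + 1))" for m
  proof -
    have "2 \<le> \<bar>x - (m - 1)\<bar> + \<bar>x - (m + 1)\<bar>"
      by linarith
    then have "1 \<le> 1/2 * \<bar>x - (m - 1)\<bar> + (1 - 1/2) * \<bar>x - (m + 1)\<bar>"
      by simp
    then show ?thesis
      by (subst nn_integral_two_point) (auto simp del: ennreal_plus)
  qed
  from this[of 2] this[of 10] show
    "1 \<le> (\<integral>\<^sup>+d. ennreal \<bar>x - d\<bar> \<partial>two_point (1/2) 1 3)"
    "1 \<le> (\<integral>\<^sup>+d. ennreal \<bar>x - d\<bar> \<partial>two_point (1/2) 9 11)" by simp_all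
qed

lemma ambiguityD:
  assumes "Q \<in> ambiguity t"
  shows "prob_space Q" "sets Q = sets borel" "AE d in Q. d \<in> I t"
    "has_bochner_integral Q (\<lambda>d. d) (\<mu> t)"
    "has_bochner_integral Q (\<lambda>d. d\<^sup>2) ((\<mu> t)\<^sup>2 + (\<sigma> t)\<^sup>2)"
  using assms by (auto simp: ambiguity_def)

text \<open>A quadratic integrand sees only the two prescribed moments, so its expectation is the
  same under every law. The constant \<open>r\<close> leaves room for the first-stage cost.\<close>

lemma nn_integral_half_square_ambiguity:
  assumes "Q \<in> ambiguity 2" "0 \<le> r"
  shows "(\<integral>\<^sup>+d. ennreal (r + ((10 - d)\<^sup>2 + 1) / 2) \<partial>Q) = ennreal (r + 1)"
proof (rule nn_integral_eq_has_bochner_integral)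
  interpret prob_space Q using ambiguityD[OF assms(1)] by simp
  \<comment> \<open>The first 101/2 is the constant (100 + 1)/2 of the parabola, the second is half
    the second moment 10^2 + 1.\<close>
  have "has_bochner_integral Q (\<lambda>d. (r + 101 / 2) + d\<^sup>2 / 2 - 10 * d) ((r + 101 / 2) + 101 / 2 - 10 * 10)"
    using ambiguityD(4,5)[OF assms(1)] params2
    by (auto simp: has_bochner_integral_iff prob_space)
  moreover have "(\<lambda>d. (r + 101 / 2) + d\<^sup>2 / 2 - 10 * d) = (\<lambda>d. r + ((10 - d)\<^sup>2 + 1) / 2)"
    by (simp add: fun_eq_iff power2_diff field_simps)
  ultimately show "has_bochner_integral Q (\<lambda>d. r + ((10 - d)\<^sup>2 + 1) / 2) (r + 1)"
    by (simp add: add.commute)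
qed (use assms in auto)

section \<open>Second stage of the dynamic program\<close>

lemma dp_objective_2_eq:
  "dp_objective 2 V\<^sub>3 y x = (SUP Q\<in>ambiguity 2. \<integral>\<^sup>+d. ennreal \<bar>x - d\<bar> \<partial>Q)"
  using params2 by (simp add: dp_objective_def V\<^sub>3_def Psi_eq)

lemma one_le_dp_objective_2: "1 \<le> dp_objective 2 V\<^sub>3 y x"
  unfolding dp_objective_2_eq
  using one_le_nn_integral_symmetric(2) symmetric_in_ambiguity(2) by (blast intro: SUP_upper2)

lemma dp_objective_2_base_stock: "dp_objective 2 V\<^sub>3 y 10 = 1"
proof (rule antisym[OF _ one_le_dp_objective_2])
  have "(\<integral>\<^sup>+d. ennreal \<bar>10 - d\<bar> \<partial>Q) \<le> 1" if "Q \<in> ambiguity 2" for Q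
  proof -
    have "(\<integral>\<^sup>+d. ennreal \<bar>10 - d\<bar> \<partial>Q) \<le> (\<integral>\<^sup>+d. ennreal (0 + ((10 - d)\<^sup>2 + 1) / 2) \<partial>Q)"
      using abs_le_half_square by (intro nn_integral_mono ennreal_leI) simp
    then show ?thesis
      using nn_integral_half_square_ambiguity[OF that, of 0] by simp
  qed
  then show "dp_objective 2 V\<^sub>3 y 10 \<le> 1"
    unfolding dp_objective_2_eq by (rule SUP_least)
qed

text \<open>Covers \<open>y\<close> above 10 as well, since the first-stage lower bound must hold
  for arbitrarily large orders.\<close>

lemma one_le_V2: "1 \<le> V\<^sub>2 y"
  unfolding V\<^sub>2_def dp_value_def by (intro INF_greatest one_le_dp_objective_2)

lemma V2_eq: "y \<le> 10 \<Longrightarrow> V\<^sub>2 y = 1"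
  using INF_lower[of 10 "{y..}" "dp_objective 2 V\<^sub>3 y"] one_le_V2[of y]
  by (auto simp: V\<^sub>2_def dp_value_def dp_objective_2_base_stock)

lemma base_stock_in_Y2: "y \<le> 10 \<Longrightarrow> 10 \<in> Y\<^sub>2 y"
  using V2_eq by (simp add: Y\<^sub>2_def dp_minimizers_def dp_objective_2_base_stock V\<^sub>2_def)

lemma shifted_not_in_Y2:
  assumes "y \<le> 10"
  shows "19/2 \<notin> Y\<^sub>2 y"
proof
  assume "19/2 \<in> Y\<^sub>2 y"
  then have "dp_objective 2 V\<^sub>3 y (19/2) = 1"
    using V2_eq[OF assms] by (simp add: Y\<^sub>2_def dp_minimizers_def V\<^sub>2_def)
  \<comment> \<open>The left-hand side is 1/5 * 3/2 + 4/5 * 1 = 11/10.\<close>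
  then have "(\<integral>\<^sup>+d. ennreal \<bar>19/2 - d\<bar> \<partial>two_point (1/5) 8 (21/2)) \<le> 1"
    using SUP_upper[OF skewed_in_ambiguity, of "\<lambda>Q. \<integral>\<^sup>+d. ennreal \<bar>19/2 - d\<bar> \<partial>Q"]
    unfolding dp_objective_2_eq by simp
  then show False
    by (subst (asm) nn_integral_two_point) (auto simp flip: ennreal_1)
qed

section \<open>First stage of the dynamic program\<close>

lemma two_le_dp_objective_1: "2 \<le> dp_objective 1 V\<^sub>2 y x"
proof -
  interpret prob_space "two_point (1/2) 1 3" by (rule prob_space_two_point)
  have "(2::ennreal) = 1 + 1" by simp
  also have "\<dots> \<le> (\<integral>\<^sup>+d. ennreal \<bar>x - d\<bar> \<partial>two_point (1/2) 1 3) + 1"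
    by (intro add_right_mono one_le_nn_integral_symmetric)
  \<comment> \<open>The constant enters the integral before it is compared with
    \<open>V\<^sub>2\<close>, so that monotonicity suffices and measurability of
    \<open>V\<^sub>2\<close> never arises.\<close>
  also have "\<dots> = (\<integral>\<^sup>+d. ennreal \<bar>x - d\<bar> + 1 \<partial>two_point (1/2) 1 3)"
    by (subst nn_integral_add) (auto simp: emeasure_space_1)
  also have "\<dots> \<le> (\<integral>\<^sup>+d. ennreal (\<Psi> 1 x d) + ennreal \<rho> * V\<^sub>2 (x - d) \<partial>two_point (1/2) 1 3)"
    by (intro nn_integral_mono) (auto simp: Psi_eq params_simps one_le_V2 intro!: add_left_mono)
  also have "\<dots> \<le> dp_objective 1 V\<^sub>2 y x"
    using params1 symmetric_in_ambiguity(1) by (auto simp: dp_objective_def intro: SUP_upper2)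
  finally show ?thesis .
qed

text \<open>On [1, 3] the first cost is at most 1 and the remaining inventory \<open>2 - d\<close>
  is below 10, so the integrand is at most 2 pointwise.\<close>

lemma dp_objective_1_mean: "dp_objective 1 V\<^sub>2 y 2 = 2"
proof (rule antisym[OF _ two_le_dp_objective_1])
  have "(\<integral>\<^sup>+d. ennreal (\<Psi> 1 2 d) + ennreal \<rho> * V\<^sub>2 (2 - d) \<partial>Q) \<le> 2" if "Q \<in> ambiguity 1" for Q
  proof -
    interpret prob_space Q using ambiguityD[OF that] by simp
    have "(\<integral>\<^sup>+d. ennreal (\<Psi> 1 2 d) + ennreal \<rho> * V\<^sub>2 (2 - d) \<partial>Q) \<le> (\<integral>\<^sup>+d. ennreal 1 + 1 \<partial>Q)"
    proof (rule nn_integral_mono_AE, use ambiguityD(3)[OF that] in eventually_elim)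
      case (elim d)
      then show ?case
        using params1 by (auto simp: Psi_eq V2_eq params_simps intro!: add_right_mono ennreal_leI simp del: ennreal_1)
    qed
    then show ?thesis by (simp add: emeasure_space_1)
  qed
  then show "dp_objective 1 V\<^sub>2 y 2 \<le> 2"
    using params1 by (auto simp: dp_objective_def intro!: SUP_least)
qed

lemma mean_in_Y1: "2 \<in> Y\<^sub>1 y\<^sub>1"
proof -
  have "dp_value 1 V\<^sub>2 y\<^sub>1 = dp_objective 1 V\<^sub>2 y\<^sub>1 2"
    unfolding dp_value_def
    by (rule antisym[OF INF_lower INF_greatest])
      (use two_le_dp_objective_1 in \<open>auto simp: params_simps dp_objective_1_mean simp del: One_nat_def\<close>)
  then show ?thesis
    by (simp add: Y\<^sub>1_def dp_minimizers_def params_simps)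
qed

section \<open>The multistage-static problem\<close>

lemma two_le_static_cost:
  assumes "\<pi> \<in> policies"
  shows "2 \<le> static_cost \<pi>"
proof -
  obtain x\<^sub>1 x\<^sub>2 where \<pi>: "\<pi> = (x\<^sub>1, x\<^sub>2)" and x2: "x\<^sub>2 \<in> borel_measurable (restrict_space borel {0..})"
    using assms by (auto simp: policies_def)
  \<comment> \<open>A Borel function on the whole line, equal to \<open>x\<^sub>2\<close> on the
    nonnegative demands, where alone \<open>x\<^sub>2\<close> is known to be measurable.\<close>
  define x where "x d = x\<^sub>2 (max d 0)" for d
  have [measurable]: "x \<in> borel_measurable borel"
    unfolding x_def by (rule measurable_compose[OF _ x2]) (auto intro!: measurable_restrict_space2)
  let ?Q1 = "two_point (1/2) 1 3" and ?Q2 = "two_point (1/2) 9 11"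
  interpret Q1: prob_space ?Q1 by (rule prob_space_two_point)
  interpret Q2: prob_space ?Q2 by (rule prob_space_two_point)
  interpret Q12: pair_prob_space ?Q1 ?Q2 ..
  have eq: "AE (d\<^sub>1, d\<^sub>2) in ?Q1 \<Otimes>\<^sub>M ?Q2. ennreal (Z \<pi> d\<^sub>1 d\<^sub>2) = ennreal \<bar>x\<^sub>1 - d\<^sub>1\<bar> + ennreal \<bar>x d\<^sub>1 - d\<^sub>2\<bar>"
  proof -
    have "AE d in ?Q1. 0 \<le> d" by (simp add: AE_two_point_iff)
    then have "AE z in ?Q1 \<Otimes>\<^sub>M ?Q2. 0 \<le> fst z"
      by (rule Q12.AE_pair_fst) measurable
    then show ?thesis
      by eventually_elim (auto simp: \<pi> Z_eq x_def max_def)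
  qed
  have "(2::ennreal) = 1 + 1" by simp
  also have "\<dots> \<le> (\<integral>\<^sup>+d. ennreal \<bar>x\<^sub>1 - d\<bar> \<partial>?Q1) + 1"
    by (intro add_right_mono one_le_nn_integral_symmetric)
  also have "\<dots> = (\<integral>\<^sup>+d. ennreal \<bar>x\<^sub>1 - d\<bar> + 1 \<partial>?Q1)"
    by (subst nn_integral_add) (auto simp: Q1.emeasure_space_1)
  also have "\<dots> \<le> (\<integral>\<^sup>+d\<^sub>1. ennreal \<bar>x\<^sub>1 - d\<^sub>1\<bar> + (\<integral>\<^sup>+d\<^sub>2. ennreal \<bar>x d\<^sub>1 - d\<^sub>2\<bar> \<partial>?Q2) \<partial>?Q1)"
    by (intro nn_integral_mono add_left_mono one_le_nn_integral_symmetric)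
  also have "\<dots> = (\<integral>\<^sup>+d\<^sub>1. \<integral>\<^sup>+d\<^sub>2. ennreal \<bar>x\<^sub>1 - d\<^sub>1\<bar> + ennreal \<bar>x d\<^sub>1 - d\<^sub>2\<bar> \<partial>?Q2 \<partial>?Q1)"
    by (subst nn_integral_add) (auto simp: Q2.emeasure_space_1)
  also have "\<dots> = (\<integral>\<^sup>+(d\<^sub>1, d\<^sub>2). ennreal \<bar>x\<^sub>1 - d\<^sub>1\<bar> + ennreal \<bar>x d\<^sub>1 - d\<^sub>2\<bar> \<partial>(?Q1 \<Otimes>\<^sub>M ?Q2))"
    by (subst Q2.nn_integral_fst[symmetric]) auto
  also have "\<dots> = (\<integral>\<^sup>+(d\<^sub>1, d\<^sub>2). ennreal (Z \<pi> d\<^sub>1 d\<^sub>2) \<partial>(?Q1 \<Otimes>\<^sub>M ?Q2))"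
    by (rule nn_integral_cong_AE) (use eq in \<open>auto simp: case_prod_unfold\<close>)
  also have "\<dots> \<le> static_cost \<pi>"
    unfolding static_cost_def joint_ambiguity_def
    using symmetric_in_ambiguity by (intro SUP_upper) auto
  finally show ?thesis .
qed

text \<open>Slope 0 is the base-stock policy; slope 1/2 gives the levels 9.5 and 10.5 after the
  demands 1 and 3.\<close>

definition tilted_policy :: "real \<Rightarrow> real \<times> (real \<Rightarrow> real)" where
  "tilted_policy k = (2, \<lambda>d. 10 + k * (d - 2))"

lemma tilted_policy_in_policies:
  assumes "0 \<le> k" "k \<le> 1/2"
  shows "tilted_policy k \<in> policies"
proof -
  have "2 - d \<le> 10 + k * (d - 2)" if "0 \<le> d" for d
  proof -
    have "0 \<le> k * d" using assms that by simp
    then have "2 \<le> 10 + d + (k * d - k * 2)" using assms that by linarith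
    then show ?thesis by (simp add: algebra_simps)
  qed
  then show ?thesis
    by (auto simp: policies_def tilted_policy_def params_simps intro!: measurable_restrict_space1)
qed

text \<open>The law is a product, so \<open>d\<^sub>1\<close> can be integrated first. The chord
  term is a multiple of \<open>d\<^sub>1 - 2\<close> and vanishes in the mean; what remains is 1
  plus the parabola in \<open>d\<^sub>2\<close>, of expectation 2 under every
  \<open>Q2\<close>.\<close>

lemma static_cost_tilted_policy:
  assumes "0 \<le> k" "k \<le> 1/2"
  shows "static_cost (tilted_policy k) \<le> 2"
  unfolding static_cost_def
proof (rule SUP_least)
  fix Q assume "Q \<in> joint_ambiguity"
  then obtain Q1 Q2 where Q: "Q = Q1 \<Otimes>\<^sub>M Q2" and Q1: "Q1 \<in> ambiguity 1" and Q2: "Q2 \<in> ambiguity 2"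
    by (auto simp: joint_ambiguity_def)
  interpret Q1: prob_space Q1 using ambiguityD[OF Q1] by simp
  interpret Q2: prob_space Q2 using ambiguityD[OF Q2] by simp
  interpret Q12: pair_prob_space Q1 Q2 ..
  note [measurable_cong] = ambiguityD(2)[OF Q1] ambiguityD(2)[OF Q2]
  let ?cost = "\<lambda>d\<^sub>1 d\<^sub>2. \<bar>2 - d\<^sub>1\<bar> + \<bar>10 + k * (d\<^sub>1 - 2) - d\<^sub>2\<bar>"
  have inner: "(\<integral>\<^sup>+d\<^sub>1. ennreal (?cost d\<^sub>1 d\<^sub>2) \<partial>Q1) \<le> ennreal (1 + ((10 - d\<^sub>2)\<^sup>2 + 1) / 2)" for d\<^sub>2
  proof -
    define u where "u = d\<^sub>2 - 10"
    define m where "m = (\<bar>u - k\<bar> - \<bar>u + k\<bar>) / 2"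
    define A where "A = 1 + (u\<^sup>2 + 1) / 2"
    have le: "AE d in Q1. ?cost d d\<^sub>2 \<le> A + (d - 2) * m"
      using ambiguityD(3)[OF Q1]
    proof eventually_elim
      case (elim d)
      have "\<bar>10 + k * (d - 2) - d\<^sub>2\<bar> = \<bar>u - k * (d - 2)\<bar>" by (simp add: u_def)
      also have "\<dots> \<le> (u\<^sup>2 + 1) / 2 + (d - 2) * m"
        unfolding m_def using elim params1 assms by (intro abs_diff_le_chord) auto
      finally show ?case using elim params1 unfolding A_def by auto
    qed
    have "has_bochner_integral Q1 (\<lambda>d. A + (d - 2) * m) (A + (2 - 2) * m)"
      using ambiguityD(4)[OF Q1] params1 by (auto simp: has_bochner_integral_iff Q1.prob_space)
    \<comment> \<open>The affine bound is nonnegative because it dominates a sum of absolute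
      values.\<close>
    moreover have "AE d in Q1. 0 \<le> A + (d - 2) * m"
      using le by eventually_elim linarith
    ultimately have "(\<integral>\<^sup>+d. ennreal (A + (d - 2) * m) \<partial>Q1) = ennreal A"
      by (subst nn_integral_eq_has_bochner_integral) auto
    moreover have "(\<integral>\<^sup>+d. ennreal (?cost d d\<^sub>2) \<partial>Q1) \<le> (\<integral>\<^sup>+d. ennreal (A + (d - 2) * m) \<partial>Q1)"
      by (rule nn_integral_mono_AE, use le in eventually_elim) (rule ennreal_leI)
    ultimately show ?thesis by (simp add: A_def u_def power2_commute)
  qed
  have "(\<integral>\<^sup>+(d\<^sub>1, d\<^sub>2). ennreal (Z (tilted_policy k) d\<^sub>1 d\<^sub>2) \<partial>Q)
      = (\<integral>\<^sup>+d\<^sub>2. \<integral>\<^sup>+d\<^sub>1. ennreal (?cost d\<^sub>1 d\<^sub>2) \<partial>Q1 \<partial>Q2)"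
    unfolding Q tilted_policy_def Z_eq by (subst Q12.nn_integral_snd[symmetric]) auto
  also have "\<dots> \<le> (\<integral>\<^sup>+d\<^sub>2. ennreal (1 + ((10 - d\<^sub>2)\<^sup>2 + 1) / 2) \<partial>Q2)"
    by (intro nn_integral_mono inner)
  also have "\<dots> = 2"
    using nn_integral_half_square_ambiguity[OF Q2, of 1] by simp
  finally show "(\<integral>\<^sup>+(d\<^sub>1, d\<^sub>2). ennreal (Z (tilted_policy k) d\<^sub>1 d\<^sub>2) \<partial>Q) \<le> 2" .
qed

lemma static_optimal_tilted_policy:
  assumes "0 \<le> k" "k \<le> 1/2"
  shows "static_optimal (tilted_policy k)"
  using tilted_policy_in_policies[OF assms] static_cost_tilted_policy[OF assms] two_le_static_cost
  unfolding static_optimal_def by (meson INF_greatest INF_lower antisym order_trans)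

section \<open>Robust optimality of the two policies\<close>

text \<open>After any nonnegative demand the inventory is at most 2, so the level 10 remains
  reachable and optimal.\<close>

lemma robust_wp1_optimal_untilted_policy: "robust_wp1_optimal (tilted_policy 0)"
proof -
  have "AE (d\<^sub>1, d\<^sub>2) in Q. 10 \<in> Y\<^sub>2 (2 - d\<^sub>1)" if joint: "Q \<in> joint_ambiguity" for Q
  proof -
    obtain Q1 Q2 where Q: "Q = Q1 \<Otimes>\<^sub>M Q2" and Q1: "Q1 \<in> ambiguity 1" and Q2: "Q2 \<in> ambiguity 2"
      using joint unfolding joint_ambiguity_def by blast
    interpret Q1: prob_space Q1 using ambiguityD[OF Q1] by simp
    interpret Q2: prob_space Q2 using ambiguityD[OF Q2] by simp
    interpret Q12: pair_prob_space Q1 Q2 ..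
    note [measurable_cong] = ambiguityD(2)[OF Q1]
    have "AE d in Q1. 0 \<le> d"
      using ambiguityD(3)[OF Q1] by (rule eventually_mono) (simp add: params1 del: One_nat_def)
    then have "AE z in Q. 0 \<le> fst z"
      unfolding Q by (rule Q12.AE_pair_fst) measurable
    then show ?thesis
      by eventually_elim (auto intro: base_stock_in_Y2)
  qed
  then show ?thesis
    using tilted_policy_in_policies[of 0] mean_in_Y1
    by (simp add: robust_wp1_optimal_def tilted_policy_def)
qed

lemma not_robust_wp1_optimal_tilted_policy: "\<not> robust_wp1_optimal (tilted_policy (1/2))"
proof
  assume "robust_wp1_optimal (tilted_policy (1/2))"
  moreover
  let ?Q1 = "two_point (1/2) 1 3" and ?Q2 = "two_point (1/2) 9 11"
  interpret Q1: prob_space ?Q1 by (rule prob_space_two_point)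
  interpret Q2: prob_space ?Q2 by (rule prob_space_two_point)
  interpret Q12: pair_prob_space ?Q1 ?Q2 ..
  have "?Q1 \<Otimes>\<^sub>M ?Q2 \<in> joint_ambiguity"
    using symmetric_in_ambiguity by (auto simp: joint_ambiguity_def)
  ultimately have "AE (d\<^sub>1, d\<^sub>2) in ?Q1 \<Otimes>\<^sub>M ?Q2. 10 + 1/2 * (d\<^sub>1 - 2) \<in> Y\<^sub>2 (2 - d\<^sub>1)"
    by (auto simp: robust_wp1_optimal_def tilted_policy_def)
  then have "AE d\<^sub>1 in ?Q1. AE d\<^sub>2 in ?Q2. 10 + 1/2 * (d\<^sub>1 - 2) \<in> Y\<^sub>2 (2 - d\<^sub>1)"
    by (auto dest: Q12.AE_pair)
  \<comment> \<open>The condition is free of \<open>d\<^sub>2\<close>, and \<open>?Q2\<close> is not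
    the null measure.\<close>
  then have "AE d\<^sub>1 in ?Q1. 10 + 1/2 * (d\<^sub>1 - 2) \<in> Y\<^sub>2 (2 - d\<^sub>1)"
    by simp
  \<comment> \<open>The demand 1 is an atom; it leaves inventory 1 and the level 19/2.\<close>
  then have "10 + 1/2 * (1 - 2) \<in> Y\<^sub>2 (2 - 1)"
    by (rule AE_two_pointD) auto
  then show False
    using shifted_not_in_Y2[of 1] by simp
qed

lemma weakly_but_not_strongly_time_consistent:
  "weakly_time_consistent \<and> \<not> strongly_time_consistent"
proof -
  have "static_optimal (tilted_policy 0)" "static_optimal (tilted_policy (1/2))"
    by (simp_all add: static_optimal_tilted_policy)
  then show ?thesis
    unfolding weakly_time_consistent_def strongly_time_consistent_def time_consistent_def
    using robust_wp1_optimal_untilted_policy not_robust_wp1_optimal_tilted_policy by blast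
qed

end

theorem theorem6:
  fixes \<rho> y\<^sub>1 :: real
    and c b h \<mu> \<sigma> :: "nat \<Rightarrow> real"
    and I :: "nat \<Rightarrow> real set"
  assumes "y\<^sub>1 = 0" and "\<rho> = 1"
    and "I 1 = {1..3}" and "\<mu> 1 = 2" and "\<sigma> 1 = 1"
    and "c 1 = 0" and "b 1 = 1" and "h 1 = 1"
    and "I 2 = {0..}" and "\<mu> 2 = 10" and "\<sigma> 2 = 1"
    and "c 2 = 0" and "b 2 = 1" and "h 2 = 1"
  shows "two_stage_inventory.weakly_time_consistent \<rho> y\<^sub>1 c b h I \<mu> \<sigma> \<and>
    \<not> two_stage_inventory.strongly_time_consistent \<rho> y\<^sub>1 c b h I \<mu> \<sigma>"
proof -
  interpret counterexample_instance \<rho> y\<^sub>1 c b h I \<mu> \<sigma>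
    using assms by unfold_locales (auto simp: is_interval_cc)
  show ?thesis
    by (rule weakly_but_not_strongly_time_consistent)
qed

end
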